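(* Let $L\geq 2$ and $M\geq 2$ be integers, and let $(X_n)_{n\ge0}$ be the deterministic walk in an i.i.d. excited random environment on $\mathbb{Z}$ with maximal jump size $L$, with $M$ cookies per site and with cookie distribution $\mu$ (as defined in the context). Let $D_0$ be the cardinality of the set $\{n\ge 0: X_n=0\}$, and let $\mu_{\min}=\min\{\mu(k):k\in\{-L,\dots,L\}\}$. Then for each integer $k\ge 1$ $$(\mu_{\min})^{4Mk} \leq \mathbb{P}\left(D_0 = k\right) \leq 2\left(1-(\mu_{\min})^{2M+L-2}\right)^{k/(2LM)}.$$
   Context: For integers $a\le b$ write $[a,b]=\{a,a+1,\dots,b\}$. For positive integers $L,M$ the set of environments is $$\Omega=\Omega(L,M)=\left\{\omega\in[-L,L]^{\mathbb{Z}_{\ge0}\times\mathbb{Z}}:\ \omega(j,z)=\omega(M-1,z)\text{ for all } j\ge M-1 \text{ and all } z\in\mathbb{Z}\right\}.$$ The values $\omega(0,z),\dots,\omega(M-1,z)$ are called the cookies at $z$. $\Omega$ is equipped with the probability measure $\mathbb{P}$ under which $\{\omega(j,z): 0\le j\le M-1,\ z\in\mathbb{Z}\}$ are i.i.d. with distribution $\mu$ on $[-L,L]$, where $\mu(k)>0$ for every $k\in[-L,L]$. For $\omega\in\Omega$ the walk $X_t=X_t(\omega)$ is defined recursively by $X_0=0$ and $X_{t+1}=X_t+\omega(L_t(X_t),X_t)$, where $L_t(z)=L_t(\omega,z)=|\{0\le j<t: X_j=z\}|$ is the number of visits to $z$ during times $0,\dots,t-1$. *)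

theory Defs
  imports "HOL-Probability.Probability" "HOL-Library.Extended_Nat"
begin

type_synonym env = "nat \<times> int \<Rightarrow> int"

definition Omega :: "nat \<Rightarrow> nat \<Rightarrow> env set" where
  "Omega L M = {\<omega>. (\<forall>j z. \<omega> (j, z) \<in> {- int L..int L}) \<and>
                   (\<forall>j z. j \<ge> M - 1 \<longrightarrow> \<omega> (j, z) = \<omega> (M - 1, z))}"

(* Omega with the trace of the product sigma-algebra on functions from nat \<times> int to int *)
definition env_space :: "nat \<Rightarrow> nat \<Rightarrow> env measure" where
  "env_space L M = restrict_space (PiM UNIV (\<lambda>_. count_space UNIV)) (Omega L M)"

(* An environment is determined by its M cookies at each site. The law is the image of the
   product measure on the cookies; see env_measure_iid for the characterisation as the
   law under which the cookies are i.i.d. with distribution \<mu>. *)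
definition env_measure :: "nat \<Rightarrow> nat \<Rightarrow> int pmf \<Rightarrow> env measure" where
  "env_measure L M \<mu> =
     distr (PiM ({..<M} \<times> UNIV) (\<lambda>_. restrict_space (measure_pmf \<mu>) {- int L..int L}))
           (env_space L M) (\<lambda>c (j, z). c (min j (M - 1), z))"

definition visits :: "(nat \<Rightarrow> int) \<Rightarrow> nat \<Rightarrow> int \<Rightarrow> nat" where
  "visits X t z = card {j. j < t \<and> X j = z}"

lemma visits_cong [fundef_cong]:
  assumes "t = t'" "z = z'" "\<And>j. j < t' \<Longrightarrow> X j = Y j"
  shows "visits X t z = visits Y t' z'"
proof -
  have "{j. j < t \<and> X j = z} = {j. j < t' \<and> Y j = z'}"
    using assms by auto
  then show ?thesis by (simp add: visits_def)
qed

fun walk :: "env \<Rightarrow> nat \<Rightarrow> int" where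
  "walk \<omega> 0 = 0"
| "walk \<omega> (Suc t) = walk \<omega> t + \<omega> (visits (\<lambda>j. walk \<omega> j) t (walk \<omega> t), walk \<omega> t)"

definition D0 :: "env \<Rightarrow> enat" where
  "D0 \<omega> = (if finite {n. walk \<omega> n = 0} then enat (card {n. walk \<omega> n = 0}) else \<infinity>)"

definition mu_min :: "nat \<Rightarrow> int pmf \<Rightarrow> real" where
  "mu_min L \<mu> = Min (pmf \<mu> ` {- int L..int L})"

lemma space_env_space [simp]: "space (env_space L M) = Omega L M"
  by (simp add: env_space_def space_restrict_space space_PiM PiE_def extensional_def)

lemma space_env_measure [simp]: "space (env_measure L M \<mu>) = Omega L M"
  by (simp add: env_measure_def)

lemma sets_env_measure [simp, measurable_cong]:
  "sets (env_measure L M \<mu>) = sets (env_space L M)"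
  by (simp add: env_measure_def)

lemma measurable_env_coord [measurable]:
  "(\<lambda>\<omega>. \<omega> i) \<in> env_space L M \<rightarrow>\<^sub>M count_space UNIV"
  unfolding env_space_def
  by (rule measurable_restrict_space1) (rule measurable_component_singleton, simp)

lemma prob_space_cookie:
  assumes "set_pmf \<mu> \<subseteq> {- int L..int L}"
  shows "prob_space (restrict_space (measure_pmf \<mu>) {- int L..int L})"
proof (rule prob_space_restrict_space)
  show "emeasure (measure_pmf \<mu>) {- int L..int L} = 1"
    using assms by (intro measure_pmf.emeasure_eq_1_AE) (auto simp: AE_measure_pmf_iff)
qed simp

lemma measurable_cookie_extension:
  assumes "M \<ge> 1"
  shows "(\<lambda>c (j, z). c (min j (M - 1), z)) \<in>
    PiM ({..<M} \<times> UNIV) (\<lambda>_. restrict_space (measure_pmf \<mu>) {- int L..int L}) \<rightarrow>\<^sub>M env_space L M"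
    (is "?f \<in> PiM ?I (\<lambda>_. ?R) \<rightarrow>\<^sub>M _")
  unfolding env_space_def
proof (rule measurable_restrict_space2)
  have min: "(min j (M - 1), z) \<in> ?I" for j z using assms by auto
  show "?f \<in> space (PiM ?I (\<lambda>_. ?R)) \<rightarrow> Omega L M"
  proof
    fix c assume "c \<in> space (PiM ?I (\<lambda>_. ?R))"
    then have "c i \<in> {- int L..int L}" if "i \<in> ?I" for i
      using that by (auto simp: space_PiM space_restrict_space PiE_iff)
    from this[OF min] show "?f c \<in> Omega L M"
      by (auto simp: Omega_def)
  qed
  show "?f \<in> PiM ?I (\<lambda>_. ?R) \<rightarrow>\<^sub>M PiM UNIV (\<lambda>_. count_space UNIV)"
  proof (rule measurable_PiM_single')
    fix i :: "nat \<times> int"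
    obtain j z where i: "i = (j, z)" by (cases i)
    have "(\<lambda>c. c (min j (M - 1), z)) \<in> PiM ?I (\<lambda>_. ?R) \<rightarrow>\<^sub>M ?R"
      using min by (rule measurable_component_singleton)
    moreover have "(\<lambda>x. x) \<in> ?R \<rightarrow>\<^sub>M count_space UNIV"
      by (rule measurable_restrict_space1) simp
    ultimately have "(\<lambda>c. c (min j (M - 1), z)) \<in> PiM ?I (\<lambda>_. ?R) \<rightarrow>\<^sub>M count_space UNIV"
      by (rule measurable_compose)
    then show "(\<lambda>c. ?f c i) \<in> PiM ?I (\<lambda>_. ?R) \<rightarrow>\<^sub>M count_space UNIV"
      by (simp add: i)
  qed auto
qed

lemma prob_space_env_measure:
  assumes "M \<ge> 1" "set_pmf \<mu> \<subseteq> {- int L..int L}"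
  shows "prob_space (env_measure L M \<mu>)"
  unfolding env_measure_def
  by (intro prob_space.prob_space_distr prob_space_PiM prob_space_cookie
        measurable_cookie_extension assms)

lemma env_measure_iid:
  assumes M: "M \<ge> 1" and \<mu>: "set_pmf \<mu> \<subseteq> {- int L..int L}"
  shows "prob_space.indep_vars (env_measure L M \<mu>) (\<lambda>_. count_space UNIV) (\<lambda>i \<omega>. \<omega> i) ({..<M} \<times> UNIV)"
    and "j < M \<Longrightarrow> distr (env_measure L M \<mu>) (count_space UNIV) (\<lambda>\<omega>. \<omega> (j, z)) = measure_pmf \<mu>"
proof -
  let ?S = "{- int L..int L}"
  let ?I = "{..<M} \<times> (UNIV :: int set)"
  define R where "R = restrict_space (measure_pmf \<mu>) ?S"
  define f :: "env \<Rightarrow> env" where "f = (\<lambda>c (j, z). c (min j (M - 1), z))"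
  let ?P = "env_measure L M \<mu>"
  interpret P: prob_space ?P using assms by (rule prob_space_env_measure)
  have P: "?P = distr (PiM ?I (\<lambda>_. R)) (env_space L M) f"
    by (simp add: env_measure_def R_def f_def)
  have f [measurable]: "f \<in> PiM ?I (\<lambda>_. R) \<rightarrow>\<^sub>M env_space L M"
    unfolding R_def f_def using M by (rule measurable_cookie_extension)
  have R: "prob_space R" unfolding R_def using \<mu> by (rule prob_space_cookie)
  have fi: "f c i = c i" if "i \<in> ?I" for c i
    using that by (auto simp: f_def min_def)
  have coord: "(\<lambda>\<omega>. \<omega> i) \<in> env_space L M \<rightarrow>\<^sub>M R" for i
    unfolding R_def
  proof (rule measurable_restrict_space2)
    show "(\<lambda>\<omega>. \<omega> i) \<in> space (env_space L M) \<rightarrow> ?S"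
      by (cases i) (auto simp: Omega_def)
    show "(\<lambda>\<omega>. \<omega> i) \<in> env_space L M \<rightarrow>\<^sub>M measure_pmf \<mu>"
      using measurable_env_coord[of i L M] by (simp cong: measurable_cong_sets)
  qed
  have marg: "distr ?P R (\<lambda>\<omega>. \<omega> i) = R" if i: "i \<in> ?I" for i
  proof -
    have "distr ?P R (\<lambda>\<omega>. \<omega> i) = distr (PiM ?I (\<lambda>_. R)) R (\<lambda>c. c i)"
      unfolding P by (subst distr_distr[OF coord f]) (simp add: comp_def fi[OF i])
    also have "\<dots> = R"
      using R i by (rule distr_PiM_component)
    finally show ?thesis .
  qed
  have rest: "(\<lambda>\<omega>. \<lambda>i\<in>?I. \<omega> i) \<in> env_space L M \<rightarrow>\<^sub>M PiM ?I (\<lambda>_. R)"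
    by (intro measurable_restrict coord)
  have "distr ?P (PiM ?I (\<lambda>_. R)) (\<lambda>\<omega>. \<lambda>i\<in>?I. \<omega> i) = distr (PiM ?I (\<lambda>_. R)) (PiM ?I (\<lambda>_. R)) (\<lambda>c. c)"
    unfolding P distr_distr[OF rest f]
  proof (rule distr_cong)
    fix c assume "c \<in> space (PiM ?I (\<lambda>_. R))"
    then have c: "c \<in> extensional ?I" by (auto simp: space_PiM PiE_iff)
    have "((\<lambda>\<omega>. \<lambda>i\<in>?I. \<omega> i) \<circ> f) c = restrict c ?I"
      using fi by (auto simp: fun_eq_iff restrict_def)
    then show "((\<lambda>\<omega>. \<lambda>i\<in>?I. \<omega> i) \<circ> f) c = c"
      using c by (simp add: extensional_restrict)
  qed auto
  also have "\<dots> = PiM ?I (\<lambda>_. R)" by (rule distr_id)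
  also have "\<dots> = PiM ?I (\<lambda>i. distr ?P R (\<lambda>\<omega>. \<omega> i))"
    by (intro PiM_cong refl marg[symmetric])
  finally have eq: "distr ?P (PiM ?I (\<lambda>_. R)) (\<lambda>\<omega>. \<lambda>i\<in>?I. \<omega> i) = PiM ?I (\<lambda>i. distr ?P R (\<lambda>\<omega>. \<omega> i))" .
  have coordP: "(\<lambda>\<omega>. \<omega> i) \<in> ?P \<rightarrow>\<^sub>M R" for i
    using coord by (simp cong: measurable_cong_sets)
  have ne: "?I \<noteq> {}" using M by (auto simp: lessThan_empty_iff)
  have "P.indep_vars (\<lambda>_. R) (\<lambda>i \<omega>. \<omega> i) ?I"
    using eq by (subst P.indep_vars_iff_distr_eq_PiM'[OF ne coordP]) auto
  moreover have incl: "(\<lambda>x. x) \<in> R \<rightarrow>\<^sub>M count_space UNIV"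
    unfolding R_def by (rule measurable_restrict_space1) simp
  ultimately show "P.indep_vars (\<lambda>_. count_space UNIV) (\<lambda>i \<omega>. \<omega> i) ?I"
    by (rule P.indep_vars_compose2[where Y = "\<lambda>_ x. x"])
  assume j: "j < M"
  have "distr ?P (count_space UNIV) (\<lambda>\<omega>. \<omega> (j, z)) = distr (distr ?P R (\<lambda>\<omega>. \<omega> (j, z))) (count_space UNIV) (\<lambda>x. x)"
    by (subst distr_distr[OF incl coordP]) (simp add: comp_def)
  also have "\<dots> = distr R (count_space UNIV) (\<lambda>x. x)"
    using j by (simp add: marg)
  also have "\<dots> = measure_pmf \<mu>"
  proof (rule measure_eqI)
    fix A assume "A \<in> sets (distr R (count_space UNIV) (\<lambda>x. x))"
    have "emeasure (distr R (count_space UNIV) (\<lambda>x. x)) A = emeasure R (A \<inter> ?S)"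
      by (subst emeasure_distr[OF incl]) (auto simp: R_def space_restrict_space)
    also have "\<dots> = emeasure (measure_pmf \<mu>) (A \<inter> ?S)"
      unfolding R_def by (subst emeasure_restrict_space) auto
    also have "\<dots> = emeasure (measure_pmf \<mu>) A"
      using \<mu> by (intro emeasure_eq_AE) (auto simp: AE_measure_pmf_iff)
    finally show "emeasure (distr R (count_space UNIV) (\<lambda>x. x)) A = emeasure (measure_pmf \<mu>) A" .
  qed simp
  finally show "distr ?P (count_space UNIV) (\<lambda>\<omega>. \<omega> (j, z)) = measure_pmf \<mu>" .
qed

lemma measurable_walk [measurable]:
  "(\<lambda>\<omega>. walk \<omega> t) \<in> env_space L M \<rightarrow>\<^sub>M count_space UNIV"
proof (induction t rule: less_induct)
  case (less t)
  let ?C = "count_space UNIV"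
  show ?case
  proof (cases t)
    case (Suc s)
    have w [measurable]: "(\<lambda>\<omega>. walk \<omega> j) \<in> env_space L M \<rightarrow>\<^sub>M ?C" if "j < Suc s" for j
      using less that Suc by auto
    have w_s: "(\<lambda>\<omega>. walk \<omega> s) \<in> env_space L M \<rightarrow>\<^sub>M ?C" by (rule w) simp
    have v: "(\<lambda>\<omega>. visits (\<lambda>j. walk \<omega> j) s z) \<in> env_space L M \<rightarrow>\<^sub>M ?C" for z
      unfolding visits_def
    proof (rule measurable_card)
      fix j
      show "{\<omega> \<in> space (env_space L M). j \<in> {j. j < s \<and> walk \<omega> j = z}} \<in> sets (env_space L M)"
      proof (cases "j < s")
        case True
        then have [measurable]: "(\<lambda>\<omega>. walk \<omega> j) \<in> env_space L M \<rightarrow>\<^sub>M ?C" by (intro w) simp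
        have "{\<omega> \<in> space (env_space L M). walk \<omega> j = z} \<in> sets (env_space L M)" by measurable
        then show ?thesis using True by simp
      qed simp
    qed
    have "(\<lambda>\<omega>. \<omega> (visits (\<lambda>j. walk \<omega> j) s z, z)) \<in> env_space L M \<rightarrow>\<^sub>M ?C" for z
      by (rule measurable_compose_countable[where f = "\<lambda>i \<omega>. \<omega> (i, z)", OF measurable_env_coord v])
    then have "(\<lambda>\<omega>. z + \<omega> (visits (\<lambda>j. walk \<omega> j) s z, z)) \<in> env_space L M \<rightarrow>\<^sub>M ?C" for z
      by (rule measurable_compose) simp
    then have "(\<lambda>\<omega>. walk \<omega> s + \<omega> (visits (\<lambda>j. walk \<omega> j) s (walk \<omega> s), walk \<omega> s))
        \<in> env_space L M \<rightarrow>\<^sub>M ?C"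
      by (rule measurable_compose_countable
          [where f = "\<lambda>z \<omega>. z + \<omega> (visits (\<lambda>j. walk \<omega> j) s z, z)", OF _ w_s])
    then show ?thesis unfolding Suc by simp
  qed simp
qed

lemma sets_D0_eq: "{\<omega> \<in> Omega L M. D0 \<omega> = enat k} \<in> sets (env_measure L M \<mu>)"
proof -
  have "{\<omega> \<in> Omega L M. D0 \<omega> = enat k} =
      {\<omega> \<in> space (env_space L M). (\<exists>N. \<forall>n. walk \<omega> n = 0 \<longrightarrow> n \<le> N) \<and> card {n. walk \<omega> n = 0} = k}"
    by (auto simp: D0_def finite_nat_set_iff_bounded_le split: if_splits)
  also have "\<dots> \<in> sets (env_space L M)"
    by measurable
  finally show ?thesis by simp
qed

end

theory Submission
  imports Defs "HOL-Library.Discrete_Functions"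
begin

text \<open>\<^emph>\<open>Lower bound.\<close> It suffices to exhibit one environment in which \<open>0\<close> is visited exactly \<open>k\<close> times and
the walk never leaves a set of \<open>2k+1 \<le> 4k\<close> sites: fixing the \<open>M\<close> cookies at each of these sites costs at
most a factor \<open>mu_min\<close> per cookie (\<open>prob_cylinder_ge\<close>). Since the last cookie at a site acts forever,
the returns to \<open>0\<close> have to be paid for by other sites, and each of them may serve only a bounded number
of returns. In \<open>sweep_env\<close> the walk runs out over the even sites until it meets a new one, is
reflected there by the first cookie, and comes home over the odd sites; every new even site
yields one return, and after \<open>k-1\<close> of them the walk ends up on the site \<open>2k\<close>, all of whose cookies
are \<open>0\<close>.

\<^emph>\<open>Upper bound.\<close> Suppose that \<open>0\<close> is visited \<open>k\<close> times. If between two consecutive visits to \<open>0\<close> every step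
used a last cookie, then the walk would be periodic from there on and return to \<open>0\<close> infinitely often.
Hence each return uses up one of the \<open>M-1\<close> earlier cookies of some visited site, so at least
\<open>(k-1)/(M-1)\<close> sites are visited before the last visit to \<open>0\<close> (\<open>returns_le_range\<close>). For \<open>k \<ge> M^2\<close> this
forces the walk to reach distance \<open>k/(2M)\<close> from \<open>0\<close> on one of the two sides and to come back
(\<open>many_returns_imp_far\<close>).

On the way out the walk crosses the levels \<open>0, L, 2L, \<dots>\<close>, at least \<open>k/(2LM)\<close> of them. The site
at which it first exceeds a level has not been visited before, so its cookies are independent of the
path so far, and with probability at least \<open>mu_min^M\<close> they are all \<open>0\<close> and hold the walk forever.
As jumps have size at most \<open>L\<close>, distinct levels lead to distinct sites; hence crossing \<open>m\<close> levels and still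
returning to \<open>0\<close> has probability at most \<open>(1 - mu_min^M)^m\<close> (\<open>prob_passes_barriers_le\<close>). The factor \<open>2\<close>
accounts for the two sides. For \<open>k < M^2\<close> the exponent is so small that the claimed bound is at
least \<open>1\<close> (\<open>one_le_bound_of_small\<close>).\<close>

section \<open>Local times and the path of the walk\<close>

lemma visits_mono: "s \<le> t \<Longrightarrow> visits X s z \<le> visits X t z"
  unfolding visits_def by (intro card_mono) auto

lemma visits_less: "s < t \<Longrightarrow> visits X s (X s) < visits X t (X s)"
  unfolding visits_def by (intro psubset_card_mono) auto

text \<open>The pair below is the cookie that the path consumes at time \<open>s\<close>: no cookie index is
consumed twice at the same site.\<close>
lemma inj_cookie_used: "inj (\<lambda>s. (X s, visits X s (X s)))"
proof (rule injI)
  fix s t assume "(X s, visits X s (X s)) = (X t, visits X t (X t))"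
  then show "s = t"
    using visits_less[of s t X] visits_less[of t s X] by (metis linorder_neqE_nat nat_less_le prod.inject)
qed

text \<open>To compute a walk it is enough to guess its path and check the recursion along the guess, with the
local times of the guess itself.\<close>
lemma walk_eqI:
  assumes "p 0 = 0" and "\<And>t. p (Suc t) = p t + \<omega> (visits p t (p t), p t)"
  shows "walk \<omega> t = p t"
proof (induction t rule: less_induct)
  case (less t)
  show ?case
  proof (cases t)
    case 0
    then show ?thesis using assms(1) by simp
  next
    case (Suc s)
    have "visits (walk \<omega>) s (p s) = visits p s (p s)"
      using less Suc by (intro visits_cong) auto
    then show ?thesis
      using assms(2)[of s] less[of s] Suc by simp
  qed
qed

text \<open>The walk up to time \<open>t\<close> has only looked at the sites where it has been before \<open>t\<close>. This is the
source of all independence below.\<close>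
lemma walk_cong_visited:
  assumes "\<And>s j. s < t \<Longrightarrow> \<omega> (j, walk \<omega> s) = \<omega>' (j, walk \<omega> s)"
  shows "walk \<omega>' t = walk \<omega> t"
  using assms
proof (induction t rule: less_induct)
  case (less t)
  show ?case
  proof (cases t)
    case (Suc s)
    have eq: "walk \<omega>' j = walk \<omega> j" if "j < t" for j
      using less.IH[OF that] less.prems that by auto
    have "visits (walk \<omega>') s (walk \<omega> s) = visits (walk \<omega>) s (walk \<omega> s)"
      using eq Suc by (intro visits_cong) auto
    then show ?thesis using eq[of s] less.prems[of s] Suc by simp
  qed simp
qed

lemma walk_stuck:
  assumes "\<And>j. \<omega> (j, walk \<omega> n) = 0" and "n \<le> t"
  shows "walk \<omega> t = walk \<omega> n"
  using assms(2) by (induction rule: dec_induct) (auto simp: assms(1))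

lemma Omega_range: "\<omega> \<in> Omega L M \<Longrightarrow> \<omega> (j, z) \<in> {- int L..int L}"
  unfolding Omega_def by blast

lemma Omega_last: "\<omega> \<in> Omega L M \<Longrightarrow> M - 1 \<le> j \<Longrightarrow> \<omega> (j, z) = \<omega> (M - 1, z)"
  unfolding Omega_def by blast

lemma walk_step_le:
  assumes "\<omega> \<in> Omega L M"
  shows "\<bar>walk \<omega> (Suc n) - walk \<omega> n\<bar> \<le> int L"
  using Omega_range[OF assms, of "visits (walk \<omega>) n (walk \<omega> n)" "walk \<omega> n"]
  by (simp add: abs_le_iff)

lemma D0_eq_enat_iff: "D0 \<omega> = enat k \<longleftrightarrow> finite {n. walk \<omega> n = 0} \<and> card {n. walk \<omega> n = 0} = k"
  by (auto simp: D0_def)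

section \<open>Returns to the origin and the range\<close>

text \<open>A loop that uses only last cookies is repeated forever: local times only grow, so on every later
round the walk again reads the last cookie at each site.\<close>
lemma walk_periodic:
  assumes \<omega>: "\<omega> \<in> Omega L M" and t: "t < t'" and ret: "walk \<omega> t' = walk \<omega> t"
    and old: "\<And>s. t \<le> s \<Longrightarrow> s < t' \<Longrightarrow> M - 1 \<le> visits (walk \<omega>) s (walk \<omega> s)"
  shows "t \<le> s \<Longrightarrow> M - 1 \<le> visits (walk \<omega>) s (walk \<omega> s) \<and> walk \<omega> (s + (t' - t)) = walk \<omega> s"
proof (induction s rule: less_induct)
  case (less s)
  let ?p = "t' - t"
  have v: "M - 1 \<le> visits (walk \<omega>) s (walk \<omega> s)"
  proof (cases "s < t'")
    case False
    define r where "r = s - ?p"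
    have r: "t \<le> r" "r < s" "s = r + ?p" using False t less.prems by (auto simp: r_def)
    have "M - 1 \<le> visits (walk \<omega>) r (walk \<omega> r)" "walk \<omega> s = walk \<omega> r"
      using less.IH[OF r(2,1)] r(3) by auto
    then show ?thesis
      using visits_mono[of r s "walk \<omega>" "walk \<omega> r"] r(2) by simp
  qed (use old less.prems in auto)
  have "walk \<omega> (s + ?p) = walk \<omega> s"
  proof (cases "s = t")
    case True
    then show ?thesis using ret t by simp
  next
    case False
    then obtain r where r: "s = Suc r" "t \<le> r"
      using less.prems by (cases s) auto
    have IH: "M - 1 \<le> visits (walk \<omega>) r (walk \<omega> r)" "walk \<omega> (r + ?p) = walk \<omega> r"
      using less.IH[of r] r by auto
    then have "M - 1 \<le> visits (walk \<omega>) (r + ?p) (walk \<omega> (r + ?p))"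
      using visits_mono[of r "r + ?p" "walk \<omega>" "walk \<omega> r"] by simp
    then have "\<omega> (visits (walk \<omega>) (r + ?p) (walk \<omega> r), walk \<omega> r) = \<omega> (visits (walk \<omega>) r (walk \<omega> r), walk \<omega> r)"
      using Omega_last[OF \<omega>] IH by metis
    then show ?thesis using IH(2) r(1) by simp
  qed
  with v show ?case by simp
qed

text \<open>Assign to every visit to \<open>0\<close> but the last one a cookie with index below \<open>M - 1\<close> that is consumed before
the next visit; without such a cookie the excursion would be a loop as in \<open>walk_periodic\<close>. The
assignment is injective because excursions occupy disjoint stretches of time, and a range \<open>V\<close> holds
only \<open>(M - 1) * card V\<close> such cookies.\<close>
lemma returns_le_range:
  assumes \<omega>: "\<omega> \<in> Omega L M" and fin: "finite {n. walk \<omega> n = 0}"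
  defines "T \<equiv> Max {n. walk \<omega> n = 0}"
  shows "card {n. walk \<omega> n = 0} \<le> Suc ((M - 1) * card (walk \<omega> ` {..T}))"
proof -
  let ?Z = "{n. walk \<omega> n = 0}"
  have TZ: "T \<in> ?Z"
    unfolding T_def using fin by (intro Max_in) (auto intro!: exI[of _ 0])
  have leT: "n \<le> T" if "n \<in> ?Z" for n
    unfolding T_def using fin that by (rule Max_ge)
  have ex: "\<exists>s\<ge>t. s < T \<and> (\<forall>n. t < n \<and> n \<le> s \<longrightarrow> n \<notin> ?Z) \<and> visits (walk \<omega>) s (walk \<omega> s) < M - 1"
    if t: "t \<in> ?Z - {T}" for t
  proof (rule ccontr)
    assume neg: "\<not> ?thesis"
    have tT: "t < T" using t leT by force
    define t' where "t' = (LEAST n. t < n \<and> n \<in> ?Z)"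
    have t': "t < t'" "t' \<in> ?Z"
      using LeastI[of "\<lambda>n. t < n \<and> n \<in> ?Z" T] tT TZ by (auto simp: t'_def)
    have min: "n \<notin> ?Z" if "t < n" "n < t'" for n
      using not_less_Least[of n "\<lambda>n. t < n \<and> n \<in> ?Z"] that by (auto simp: t'_def)
    have old: "M - 1 \<le> visits (walk \<omega>) s (walk \<omega> s)" if s: "t \<le> s" "s < t'" for s
    proof -
      have "s < T" using s leT[OF t'(2)] by simp
      then show ?thesis using neg min s by (meson le_less_trans not_le)
    qed
    have "t + i * (t' - t) \<in> ?Z" for i
    proof (induction i)
      case (Suc i)
      have "walk \<omega> (t + i * (t' - t) + (t' - t)) = walk \<omega> (t + i * (t' - t))"
        using walk_periodic[OF \<omega> t'(1) _ old, of "t + i * (t' - t)"] t t'(2) by simp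
      then show ?case using Suc by (simp add: ac_simps)
    qed (use t in auto)
    then have "range (\<lambda>i. t + i * (t' - t)) \<subseteq> ?Z" by blast
    moreover have "inj (\<lambda>i. t + i * (t' - t))" using t'(1) by (auto intro: injI)
    ultimately show False
      using fin by (meson finite_imageD finite_subset infinite_UNIV_nat)
  qed
  then obtain f where f: "\<And>t. t \<in> ?Z - {T} \<Longrightarrow> t \<le> f t \<and> f t < T \<and>
      (\<forall>n. t < n \<and> n \<le> f t \<longrightarrow> n \<notin> ?Z) \<and> visits (walk \<omega>) (f t) (walk \<omega> (f t)) < M - 1"
    by metis
  have "inj_on f (?Z - {T})"
  proof (rule inj_onI)
    fix t u assume tu: "t \<in> ?Z - {T}" "u \<in> ?Z - {T}" "f t = f u"
    show "t = u"
      using f[OF tu(1)] f[OF tu(2)] tu by (metis DiffD1 linorder_neqE_nat)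
  qed
  then have "inj_on ((\<lambda>s. (walk \<omega> s, visits (walk \<omega>) s (walk \<omega> s))) \<circ> f) (?Z - {T})"
    by (intro comp_inj_on inj_on_subset[OF inj_cookie_used]) auto
  moreover have "((\<lambda>s. (walk \<omega> s, visits (walk \<omega>) s (walk \<omega> s))) \<circ> f) ` (?Z - {T})
      \<subseteq> walk \<omega> ` {..T} \<times> {..<M - 1}"
  proof
    fix x assume "x \<in> ((\<lambda>s. (walk \<omega> s, visits (walk \<omega>) s (walk \<omega> s))) \<circ> f) ` (?Z - {T})"
    then obtain t where t: "t \<in> ?Z - {T}" "x = (walk \<omega> (f t), visits (walk \<omega>) (f t) (walk \<omega> (f t)))"
      by auto
    then show "x \<in> walk \<omega> ` {..T} \<times> {..<M - 1}"
      using f[OF t(1)] by (auto intro: less_imp_le)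
  qed
  ultimately have "card (?Z - {T}) \<le> card (walk \<omega> ` {..T} \<times> {..<M - 1})"
    by (rule card_inj_on_le) auto
  moreover have "card ?Z \<le> Suc (card (?Z - {T}))"
    using fin TZ by (simp add: card_Diff_singleton)
  ultimately show ?thesis by (simp add: card_cartesian_product mult.commute)
qed

text \<open>A range contained in \<open>{-c..c}\<close> with \<open>2 * M * c \<le> k - 1\<close> has at most \<open>2 * c + 1\<close> sites, and then
\<open>returns_le_range\<close> gives \<open>k - 1 \<le> M * (M - 1)\<close>, which contradicts \<open>k \<ge> M^2\<close>. The bound on the range
refers to the time before the last visit to \<open>0\<close>, so the walk comes back from the distant site.\<close>
lemma many_returns_imp_far:
  assumes \<omega>: "\<omega> \<in> Omega L M" and D: "D0 \<omega> = enat k" and M: "M \<ge> 2" and k: "k \<ge> M\<^sup>2"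
  obtains n T where "n \<le> T" "walk \<omega> T = 0" "int k \<le> 2 * int M * \<bar>walk \<omega> n\<bar>"
proof -
  let ?Z = "{n. walk \<omega> n = 0}"
  define T where "T = Max ?Z"
  have fin: "finite ?Z" and card: "card ?Z = k" using D by (auto simp: D0_eq_enat_iff)
  have T: "walk \<omega> T = 0"
    using Max_in[OF fin] walk.simps(1)[of \<omega>] by (auto simp: T_def simp del: walk.simps)
  have "\<exists>n\<le>T. int k \<le> 2 * int M * \<bar>walk \<omega> n\<bar>"
  proof (rule ccontr)
    assume "\<not> ?thesis"
    then have small: "2 * int M * \<bar>walk \<omega> n\<bar> \<le> int k - 1" if "n \<le> T" for n
      using that by force
    define c where "c = (int k - 1) div (2 * int M)"
    have "1 \<le> M\<^sup>2" using M by simp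
    then have k1: "1 \<le> k" using k by linarith
    have c0: "0 \<le> c" and c1: "2 * int M * c \<le> int k - 1"
      unfolding c_def using k1 M minus_mod_eq_mult_div[of "int k - 1" "2 * int M"]
        pos_mod_sign[of "2 * int M" "int k - 1"]
      by (simp_all add: pos_imp_zdiv_nonneg_iff del: pos_mod_sign minus_mod_eq_mult_div)
    have "\<bar>walk \<omega> n\<bar> \<le> c" if "n \<le> T" for n
      using zdiv_mono1[OF small[OF that], of "2 * int M"] M by (simp add: c_def)
    then have "walk \<omega> ` {..T} \<subseteq> {-c..c}" by (auto simp: abs_le_iff minus_le_iff)
    then have "card (walk \<omega> ` {..T}) \<le> card {-c..c}" by (intro card_mono) auto
    then have V: "int (card (walk \<omega> ` {..T})) \<le> 2 * c + 1" using c0 by simp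
    have "k \<le> Suc ((M - 1) * card (walk \<omega> ` {..T}))"
      using returns_le_range[OF \<omega> fin] card by (simp add: T_def)
    then have "int k \<le> int (Suc ((M - 1) * card (walk \<omega> ` {..T})))"
      by (simp only: of_nat_le_iff)
    also have "\<dots> = 1 + (int M - 1) * int (card (walk \<omega> ` {..T}))"
      using M by (simp add: of_nat_diff)
    also have "\<dots> \<le> 1 + (int M - 1) * (2 * c + 1)"
      using V M by (intro add_left_mono mult_left_mono) auto
    finally have "int k - 1 \<le> (int M - 1) * (2 * c + 1)" by simp
    then have "int M * (int k - 1) \<le> int M * ((int M - 1) * (2 * c + 1))"
      by (intro mult_left_mono) auto
    also have "\<dots> = (int M - 1) * (2 * int M * c + int M)" by (simp add: algebra_simps)
    also have "\<dots> \<le> (int M - 1) * (int k - 1 + int M)"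
      using c1 M by (intro mult_left_mono) auto
    finally have "int k - 1 \<le> int M * int M - int M" by (simp add: algebra_simps)
    moreover have "int M * int M \<le> int k"
      using k by (metis of_nat_le_iff of_nat_mult power2_eq_square)
    ultimately show False using M by simp
  qed
  then show ?thesis using T that by blast
qed

section \<open>Independence of sites\<close>

text \<open>Measurability with respect to the cookies at the sites in \<open>S\<close>, expressed pointwise: whether an
environment lies in the event is not affected by changes off \<open>S\<close>.\<close>
definition depends_on :: "nat \<Rightarrow> nat \<Rightarrow> int set \<Rightarrow> env set \<Rightarrow> bool" where
  "depends_on L M S A \<longleftrightarrow>
     (\<forall>\<omega>\<in>Omega L M. \<forall>\<omega>'\<in>Omega L M. (\<forall>j. \<forall>z\<in>S. \<omega> (j, z) = \<omega>' (j, z)) \<longrightarrow> \<omega> \<in> A \<longrightarrow> \<omega>' \<in> A)"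

locale iid_cookies =
  fixes L M :: nat and \<mu> :: "int pmf"
  assumes M_pos: "M \<ge> 1" and set_pmf_eq: "set_pmf \<mu> = {- int L..int L}"
begin

sublocale prob_space "env_measure L M \<mu>"
  using M_pos set_pmf_eq by (intro prob_space_env_measure) auto

lemma mu_min_le: "i \<in> {- int L..int L} \<Longrightarrow> mu_min L \<mu> \<le> pmf \<mu> i"
  unfolding mu_min_def by (intro Min_le) auto

lemma mu_min_pos: "0 < mu_min L \<mu>"
  unfolding mu_min_def using set_pmf_eq by (subst Min_gr_iff) (auto simp: pmf_positive)

lemma mu_min_le_1: "mu_min L \<mu> \<le> 1"
  by (rule order_trans[OF mu_min_le[of 0] pmf_le_1]) simp

lemma mu_min_power_le_1: "mu_min L \<mu> ^ n \<le> 1"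
  using mu_min_pos mu_min_le_1 by (intro power_le_one) auto

lemma mu_min_le_half:
  assumes "L \<ge> 1"
  shows "mu_min L \<mu> \<le> 1 / 2"
proof -
  have "pmf \<mu> 0 + pmf \<mu> 1 = measure_pmf.prob \<mu> {0, 1}"
    by (simp add: measure_measure_pmf_finite)
  then have "pmf \<mu> 0 + pmf \<mu> 1 \<le> 1" by simp
  moreover have "mu_min L \<mu> \<le> pmf \<mu> 0" "mu_min L \<mu> \<le> pmf \<mu> 1"
    using assms by (auto intro!: mu_min_le)
  ultimately show ?thesis by simp
qed

lemma indep_cookies:
  "indep_vars (\<lambda>_. count_space UNIV) (\<lambda>i \<omega>. \<omega> i) ({..<M} \<times> UNIV)"
  using env_measure_iid(1)[OF M_pos] set_pmf_eq by blast

lemma measurable_cookie [measurable]: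
  "(\<lambda>\<omega>. \<omega> i) \<in> env_measure L M \<mu> \<rightarrow>\<^sub>M count_space UNIV"
  using measurable_env_coord[of i L M] by (simp cong: measurable_cong_sets)

lemma prob_cookie:
  assumes "j < M"
  shows "prob ((\<lambda>\<omega>. \<omega> (j, z)) -` {c} \<inter> space (env_measure L M \<mu>)) = pmf \<mu> c"
proof -
  have "distr (env_measure L M \<mu>) (count_space UNIV) (\<lambda>\<omega>. \<omega> (j, z)) = measure_pmf \<mu>"
    using env_measure_iid(2)[OF M_pos _ assms] set_pmf_eq by simp
  then have "measure (distr (env_measure L M \<mu>) (count_space UNIV) (\<lambda>\<omega>. \<omega> (j, z))) {c} = pmf \<mu> c"
    by (simp add: measure_pmf_single)
  then show ?thesis by (subst (asm) measure_distr) auto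
qed

lemma prob_cylinder_ge:
  assumes S: "finite S" "S \<noteq> {}"
    and c: "\<And>j z. z \<in> S \<Longrightarrow> c (j, z) \<in> {- int L..int L}"
  shows "mu_min L \<mu> ^ (M * card S) \<le> prob {\<omega> \<in> Omega L M. \<forall>j<M. \<forall>z\<in>S. \<omega> (j, z) = c (j, z)}"
proof -
  let ?J = "{..<M} \<times> S"
  have J: "?J \<noteq> {}" "finite ?J" using S M_pos by (auto simp: lessThan_empty_iff)
  have "mu_min L \<mu> ^ (M * card S) = (\<Prod>i\<in>?J. mu_min L \<mu>)"
    by (simp add: card_cartesian_product)
  also have "\<dots> \<le> (\<Prod>i\<in>?J. prob ((\<lambda>\<omega>. \<omega> i) -` {c i} \<inter> space (env_measure L M \<mu>)))"
  proof (intro prod_mono conjI)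
    fix i assume "i \<in> ?J"
    then show "mu_min L \<mu> \<le> prob ((\<lambda>\<omega>. \<omega> i) -` {c i} \<inter> space (env_measure L M \<mu>))"
      using prob_cookie c mu_min_le by (cases i) force
  qed (use mu_min_pos in auto)
  also have "\<dots> = prob (\<Inter>i\<in>?J. (\<lambda>\<omega>. \<omega> i) -` {c i} \<inter> space (env_measure L M \<mu>))"
    by (rule indep_varsD[OF indep_cookies J, symmetric]) auto
  also have "(\<Inter>i\<in>?J. (\<lambda>\<omega>. \<omega> i) -` {c i} \<inter> space (env_measure L M \<mu>))
      = {\<omega> \<in> Omega L M. \<forall>j<M. \<forall>z\<in>S. \<omega> (j, z) = c (j, z)}"
    using J(1) by fastforce
  finally show ?thesis .
qed

text \<open>An event that depends only on \<open>S\<close> is the preimage of an event in the space of the cookies at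
\<open>S\<close>: rebuild an environment from these cookies by putting \<open>0\<close> at all other sites. Disjoint families of
independent cookies are independent, and so are the two events.\<close>
lemma prob_Int_disjoint_sites:
  assumes A: "A \<in> events" "depends_on L M S A" and B: "B \<in> events" "depends_on L M S' B"
    and disj: "S \<inter> S' = {}"
  shows "prob (A \<inter> B) = prob A * prob B"
proof -
  let ?E = "env_measure L M \<mu>"
  let ?P = "\<lambda>S :: int set. PiM ({..<M} \<times> S) (\<lambda>_. count_space (UNIV :: int set))"
  define rest where "rest = (\<lambda>(S :: int set) (\<omega> :: env). restrict (\<lambda>i. \<omega> i) ({..<M} \<times> S))"
  \<comment> \<open>needed to land in the space of environments, since the space of cookie families contains all integers\<close>
  define clip where "clip = (\<lambda>v. if v \<in> {- int L..int L} then v else 0)"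
  define ext :: "int set \<Rightarrow> env \<Rightarrow> env" where
    "ext = (\<lambda>S c (j, z). if z \<in> S then clip (c (min j (M - 1), z)) else 0)"
  have ext_Omega: "ext S c \<in> Omega L M" for S c
    by (auto simp: Omega_def ext_def clip_def)
  have ext_meas: "ext S \<in> ?P S \<rightarrow>\<^sub>M env_space L M" for S
    unfolding env_space_def
  proof (rule measurable_restrict_space2)
    show "ext S \<in> ?P S \<rightarrow>\<^sub>M PiM UNIV (\<lambda>_. count_space UNIV)"
    proof (rule measurable_PiM_single')
      fix i :: "nat \<times> int"
      obtain j z where i: "i = (j, z)" by (cases i)
      show "(\<lambda>c. ext S c i) \<in> ?P S \<rightarrow>\<^sub>M count_space UNIV"
      proof (cases "z \<in> S")
        case True
        then have "(min j (M - 1), z) \<in> {..<M} \<times> S" using M_pos by auto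
        then have "(\<lambda>c. c (min j (M - 1), z)) \<in> ?P S \<rightarrow>\<^sub>M count_space UNIV"
          by (rule measurable_component_singleton)
        then have "(\<lambda>c. clip (c (min j (M - 1), z))) \<in> ?P S \<rightarrow>\<^sub>M count_space UNIV"
          by (rule measurable_compose) simp
        then show ?thesis using True by (simp add: i ext_def)
      qed (simp add: i ext_def)
    qed auto
  qed (use ext_Omega in auto)
  have ext_rest: "ext S (rest S \<omega>) (j, z) = \<omega> (j, z)" if "\<omega> \<in> Omega L M" "z \<in> S" for S \<omega> j z
  proof -
    have "\<omega> (min j (M - 1), z) = \<omega> (j, z)"
      using Omega_last[OF that(1), of j z] by (cases "j \<le> M - 1") (simp_all add: min_def)
    moreover have "\<omega> (j, z) \<in> {- int L..int L}" using that(1) by (rule Omega_range)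
    moreover have "min j (M - 1) < M" using M_pos by auto
    ultimately show ?thesis using that(2) by (simp add: ext_def rest_def clip_def)
  qed
  have mem: "C = rest S -` (ext S -` C \<inter> space (?P S)) \<inter> space ?E"
    if C: "C \<in> events" "depends_on L M S C" for S C
  proof -
    have sub: "C \<subseteq> Omega L M" using sets.sets_into_space[OF C(1)] by simp
    have "\<omega> \<in> C \<longleftrightarrow> ext S (rest S \<omega>) \<in> C" if \<omega>: "\<omega> \<in> Omega L M" for \<omega>
      using C(2) ext_rest[OF \<omega>, of _ S] ext_Omega[of S "rest S \<omega>"] \<omega>
      unfolding depends_on_def by metis
    moreover have "rest S \<omega> \<in> space (?P S)" for \<omega>
      by (auto simp: rest_def space_PiM)
    ultimately show ?thesis using sub by auto
  qed
  have meas: "ext S -` C \<inter> space (?P S) \<in> sets (?P S)" if "C \<in> events" for S C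
    using measurable_sets[OF ext_meas, of C S] that by simp
  have "indep_var (?P S) (rest S) (?P S') (rest S')"
    unfolding rest_def
    by (rule indep_var_restrict[OF indep_cookies]) (use disj in auto)
  note ind = indep_varD[OF this meas[OF A(1), of S] meas[OF B(1), of S']]
  have "(\<lambda>\<omega>. (rest S \<omega>, rest S' \<omega>)) -`
      ((ext S -` A \<inter> space (?P S)) \<times> (ext S' -` B \<inter> space (?P S'))) \<inter> space ?E = A \<inter> B"
    by (subst (2) mem[OF A], subst (2) mem[OF B]) blast
  then show ?thesis
    using ind mem[OF A] mem[OF B] by simp
qed

end

section \<open>An environment with a prescribed number of visits\<close>

text \<open>The path of the walk in \<open>sweep_env k\<close>. Its \<open>m\<close>-th excursion, for \<open>m < k\<close>, goes
\<open>0, 2, \<dots>, 2m, 2m-1, \<dots>, 3, 1\<close> and lasts \<open>2m+1\<close> steps. Hence it starts at time \<open>m^2 - 1\<close>, and an integer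
square root recovers \<open>m\<close> and the number \<open>r\<close> of steps made since then from the time. From time \<open>k^2 + k - 1\<close> on the walk rests at \<open>2k\<close>.\<close>
definition sweep :: "nat \<Rightarrow> nat \<Rightarrow> int" where
  "sweep k t =
     (let m = floor_sqrt (Suc t); r = Suc t - m\<^sup>2 in
      if k\<^sup>2 + k \<le> Suc t then 2 * int k
      else if r \<le> m then 2 * int r else 4 * int m + 1 - 2 * int r)"

text \<open>Even sites push outwards by \<open>2\<close>, except that the first cookie at a positive one turns the walk back;
odd sites lead home.\<close>
definition sweep_env :: "nat \<Rightarrow> env" where
  "sweep_env k = (\<lambda>(j, z). if z = 2 * int k then 0
     else if z = 1 then -1
     else if odd z then -2
     else if z > 0 \<and> j = 0 then -1 else 2)"

lemma sweep_env_in_Omega: "L \<ge> 2 \<Longrightarrow> M \<ge> 2 \<Longrightarrow> sweep_env k \<in> Omega L M"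
  by (auto simp: Omega_def sweep_env_def)

lemma time_decomp:
  obtains m r where "Suc t = m\<^sup>2 + r" "r \<le> 2 * m" "m \<ge> 1"
proof -
  let ?m = "floor_sqrt (Suc t)"
  have "Suc t < (Suc ?m)\<^sup>2" by (rule Suc_floor_sqrt_power2_gt)
  then have "Suc t - ?m\<^sup>2 \<le> 2 * ?m" by (simp add: power2_eq_square)
  moreover have "?m \<ge> 1" using floor_sqrt_greater_zero_iff[of "Suc t"] by linarith
  ultimately show ?thesis
    using that[of ?m "Suc t - ?m\<^sup>2"] floor_sqrt_power2_le[of "Suc t"] by simp
qed

lemma sweep_eq:
  assumes "Suc t = m\<^sup>2 + r" "r \<le> 2 * m" "m \<ge> 1"
  shows "sweep k t = (if k\<^sup>2 + k \<le> m\<^sup>2 + r then 2 * int k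
      else if r \<le> m then 2 * int r else 4 * int m + 1 - 2 * int r)"
proof -
  have "floor_sqrt (Suc t) = m"
    using assms by (intro floor_sqrt_unique) (auto simp: power2_eq_square)
  then show ?thesis using assms by (simp add: sweep_def Let_def)
qed

text \<open>The blocks \<open>{m^2..m^2 + 2 * m}\<close> tile the positive integers, so times compare lexicographically in
the block number and the offset.\<close>
lemma frozen_iff:
  fixes m r k :: nat
  assumes "r \<le> 2 * m"
  shows "k\<^sup>2 + k \<le> m\<^sup>2 + r \<longleftrightarrow> k < m \<or> k = m \<and> k \<le> r"
proof -
  consider "Suc k \<le> m" | "k = m" | "Suc m \<le> k" by linarith
  then show ?thesis
  proof cases
    case 1
    then have "(Suc k)\<^sup>2 \<le> m\<^sup>2" by (rule power_mono) simp
    then show ?thesis using 1 by (simp add: power2_eq_square)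
  next
    case 3
    then have "(Suc m)\<^sup>2 \<le> k\<^sup>2" by (rule power_mono) simp
    then show ?thesis using 3 assms by (simp add: power2_eq_square)
  qed auto
qed

lemma visits_eq_0_iff: "visits X t z = 0 \<longleftrightarrow> (\<forall>s<t. X s \<noteq> z)"
  by (auto simp: visits_def)

lemma walk_sweep_env:
  assumes "k \<ge> 1"
  shows "walk (sweep_env k) t = sweep k t"
proof (rule walk_eqI)
  show "sweep k 0 = 0" using sweep_eq[of 0 1 0 k] frozen_iff[of 0 1 k] assms by simp
next
  fix t
  obtain m r where mr: "Suc t = m\<^sup>2 + r" "r \<le> 2 * m" "m \<ge> 1" by (rule time_decomp)
  note now = sweep_eq[OF mr, of k]
  define m' where "m' = (if r = 2 * m then Suc m else m)"
  define r' where "r' = (if r = 2 * m then 0 else Suc r)"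
  have mr': "Suc (Suc t) = m'\<^sup>2 + r'" "r' \<le> 2 * m'" "m' \<ge> 1"
    using mr by (auto simp: m'_def r'_def power2_eq_square)
  note next_pos = sweep_eq[OF mr', of k]
  show "sweep k (Suc t) = sweep k t + sweep_env k (visits (sweep k) t (sweep k t), sweep k t)"
  proof (cases "k\<^sup>2 + k \<le> m\<^sup>2 + r")
    case True
    then have "k\<^sup>2 + k \<le> m'\<^sup>2 + r'" using mr(1) mr'(1) by linarith
    then show ?thesis using True now next_pos by (simp add: sweep_env_def)
  next
    case active: False
    then have mk: "m < k \<or> m = k \<and> r < k" using frozen_iff[OF mr(2), of k] by auto
    consider "r = 0" | "0 < r" "r < m" | "r = m" | "m < r" by linarith
    then show ?thesis
    proof cases
      case 1
      then show ?thesis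
        using now next_pos active mk mr frozen_iff[OF mr'(2), of k]
        by (auto simp: sweep_env_def m'_def r'_def split: if_splits)
    next
      case 2
      \<comment> \<open>the time at which excursion \<open>r\<close> reached its turning point \<open>2r\<close>, whose first cookie is therefore used up\<close>
      define s where "s = r\<^sup>2 + r - 1"
      have s: "Suc s = r\<^sup>2 + r" "r \<le> 2 * r" "r \<ge> 1" using 2 by (auto simp: s_def)
      have "sweep k s = 2 * int r"
        using sweep_eq[OF s, of k] frozen_iff[OF s(2), of k] 2 mk by auto
      moreover have "s < t"
      proof -
        have "(Suc r)\<^sup>2 \<le> m\<^sup>2" using 2 by (intro power_mono) auto
        then show ?thesis using s(1) mr(1) by (simp add: power2_eq_square)
      qed
      ultimately have "visits (sweep k) t (2 * int r) \<noteq> 0"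
        by (auto simp: visits_eq_0_iff)
      then show ?thesis
        using now next_pos active mk mr 2 frozen_iff[OF mr'(2), of k]
        by (auto simp: sweep_env_def m'_def r'_def split: if_splits)
    next
      case 3
      then have m: "m < k" using mk by auto
      \<comment> \<open>the turning point of the current excursion is new: earlier excursions stay below it\<close>
      have "sweep k s \<noteq> 2 * int m" if "s < t" for s
      proof
        assume eq: "sweep k s = 2 * int m"
        obtain n q where nq: "Suc s = n\<^sup>2 + q" "q \<le> 2 * n" "n \<ge> 1" by (rule time_decomp)
        have "\<not> k\<^sup>2 + k \<le> n\<^sup>2 + q" using active nq(1) mr(1) that by linarith
        then have "q \<le> n" "q = m"
          using eq sweep_eq[OF nq, of k] by (auto split: if_splits) presburger+
        then have "m\<^sup>2 \<le> n\<^sup>2" by (intro power_mono) auto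
        then show False using nq(1) mr(1) 3 \<open>q = m\<close> that by linarith
      qed
      then have "visits (sweep k) t (2 * int m) = 0"
        by (auto simp: visits_eq_0_iff)
      then show ?thesis
        using now next_pos active mk mr 3 m frozen_iff[OF mr'(2), of k]
        by (auto simp: sweep_env_def m'_def r'_def split: if_splits)
    next
      case 4
      have pos: "sweep k t = 4 * int m + 1 - 2 * int r" using now active 4 by simp
      then have odd: "odd (sweep k t)" by simp
      have m: "m < k" using mk 4 by auto
      show ?thesis
      proof (cases "r = 2 * m")
        case True
        then show ?thesis
          using now next_pos active m mr 4 frozen_iff[OF mr'(2), of k]
          by (auto simp: sweep_env_def m'_def r'_def)
      next
        case False
        then have "sweep k t \<noteq> 1" "sweep k t \<noteq> 2 * int k"
          using pos by presburger+
        then have "sweep_env k (visits (sweep k) t (sweep k t), sweep k t) = -2"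
          using odd by (simp add: sweep_env_def)
        then show ?thesis
          using now next_pos active m False 4 frozen_iff[OF mr'(2), of k]
          by (auto simp: m'_def r'_def)
      qed
    qed
  qed
qed

lemma sweep_range:
  "sweep k t \<in> {0..2 * int k}"
proof -
  obtain m r where mr: "Suc t = m\<^sup>2 + r" "r \<le> 2 * m" "m \<ge> 1" by (rule time_decomp)
  show ?thesis
    using sweep_eq[OF mr, of k] frozen_iff[OF mr(2), of k] mr(2,3) by auto
qed

lemma D0_sweep:
  assumes "k \<ge> 1" and "\<And>j z. z \<in> {0..2 * int k} \<Longrightarrow> \<omega> (j, z) = sweep_env k (j, z)"
  shows "D0 \<omega> = enat k"
proof -
  have w: "walk \<omega> t = sweep k t" for t
    using walk_cong_visited[of t "sweep_env k" \<omega>] assms sweep_range[of k] walk_sweep_env[OF assms(1)]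
    by (metis (no_types, lifting))
  \<comment> \<open>the visits to \<open>0\<close> are the starts of the excursions\<close>
  have "{t. walk \<omega> t = 0} = (\<lambda>m. m\<^sup>2 - 1) ` {1..k}"
  proof (intro set_eqI iffI)
    fix t assume "t \<in> {t. walk \<omega> t = 0}"
    then have z: "sweep k t = 0" using w by simp
    obtain m r where mr: "Suc t = m\<^sup>2 + r" "r \<le> 2 * m" "m \<ge> 1" by (rule time_decomp)
    have "r = 0" "m \<le> k"
      using z sweep_eq[OF mr, of k] frozen_iff[OF mr(2), of k] assms(1) mr(2)
      by (auto split: if_splits)
    then show "t \<in> (\<lambda>m. m\<^sup>2 - 1) ` {1..k}" using mr by (intro image_eqI[of _ _ m]) auto
  next
    fix t assume "t \<in> (\<lambda>m. m\<^sup>2 - 1) ` {1..k}"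
    then obtain m where m: "t = m\<^sup>2 - 1" "1 \<le> m" "m \<le> k" by auto
    then have mr: "Suc t = m\<^sup>2 + 0" "0 \<le> 2 * m" "m \<ge> 1" by auto
    show "t \<in> {t. walk \<omega> t = 0}"
      using w sweep_eq[OF mr, of k] frozen_iff[OF mr(2), of k] m assms(1) by auto
  qed
  moreover have "inj_on (\<lambda>m. m\<^sup>2 - 1 :: nat) {1..k}"
  proof (rule inj_onI)
    fix a b :: nat assume ab: "a \<in> {1..k}" "b \<in> {1..k}" "a\<^sup>2 - 1 = b\<^sup>2 - 1"
    then have "a\<^sup>2 = b\<^sup>2" by (auto simp: eq_diff_iff)
    then show "a = b" by simp
  qed
  ultimately show ?thesis by (simp add: D0_eq_enat_iff card_image)
qed

lemma (in iid_cookies) prob_D0_ge: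
  assumes "L \<ge> 2" "M \<ge> 2" "k \<ge> 1"
  shows "mu_min L \<mu> ^ (4 * M * k) \<le> prob {\<omega> \<in> Omega L M. D0 \<omega> = enat k}"
proof -
  let ?S = "{0..2 * int k}"
  let ?C = "{\<omega> \<in> Omega L M. \<forall>j<M. \<forall>z\<in>?S. \<omega> (j, z) = sweep_env k (j, z)}"
  have env: "sweep_env k \<in> Omega L M" using assms by (simp add: sweep_env_in_Omega)
  have card: "card ?S = 2 * k + 1" by simp
  have "M * (2 * k + 1) \<le> M * (4 * k)"
    using assms by (intro mult_le_mono) auto
  then have "mu_min L \<mu> ^ (4 * M * k) \<le> mu_min L \<mu> ^ (M * card ?S)"
    unfolding card using mu_min_pos mu_min_le_half assms(1)
    by (intro power_decreasing) (auto simp: algebra_simps)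
  also have "\<dots> \<le> prob ?C"
    using Omega_range[OF env] by (intro prob_cylinder_ge) auto
  also have "\<dots> \<le> prob {\<omega> \<in> Omega L M. D0 \<omega> = enat k}"
  proof (rule finite_measure_mono)
    show "?C \<subseteq> {\<omega> \<in> Omega L M. D0 \<omega> = enat k}"
    proof safe
      fix \<omega> assume \<omega>: "\<omega> \<in> Omega L M" and eq: "\<forall>j<M. \<forall>z\<in>?S. \<omega> (j, z) = sweep_env k (j, z)"
      have "\<omega> (j, z) = sweep_env k (j, z)" if "z \<in> ?S" for j z
      proof (cases "j < M")
        case False
        then have "\<omega> (j, z) = \<omega> (M - 1, z)" "sweep_env k (j, z) = sweep_env k (M - 1, z)"
          using Omega_last[OF \<omega>, of j z] Omega_last[OF env, of j z] by auto
        then show ?thesis using eq that assms(2) by simp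
      qed (use eq that in auto)
      then show "D0 \<omega> = enat k" using assms(3) by (intro D0_sweep) auto
    qed
  qed (rule sets_D0_eq)
  finally show ?thesis .
qed

section \<open>Crossing levels\<close>

text \<open>The sign \<open>\<sigma>\<close> selects the side, so that left and right are treated at once.\<close>
definition first_beyond :: "env \<Rightarrow> int \<Rightarrow> int \<Rightarrow> nat \<Rightarrow> bool" where
  "first_beyond \<omega> \<sigma> h n \<longleftrightarrow> h < \<sigma> * walk \<omega> n \<and> (\<forall>i<n. \<sigma> * walk \<omega> i \<le> h)"

lemma first_beyond_unique: "first_beyond \<omega> \<sigma> h n \<Longrightarrow> first_beyond \<omega> \<sigma> h n' \<Longrightarrow> n = n'"
  unfolding first_beyond_def by (metis linorder_neqE_nat not_le)

lemma first_beyond_exists: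
  assumes "h < \<sigma> * walk \<omega> n"
  obtains n' where "n' \<le> n" "first_beyond \<omega> \<sigma> h n'"
proof -
  let ?n = "LEAST n. h < \<sigma> * walk \<omega> n"
  have "first_beyond \<omega> \<sigma> h ?n"
    using LeastI[of "\<lambda>n. h < \<sigma> * walk \<omega> n", OF assms] not_less_Least[of _ "\<lambda>n. h < \<sigma> * walk \<omega> n"]
    by (fastforce simp: first_beyond_def)
  then show ?thesis using that Least_le[of "\<lambda>n. h < \<sigma> * walk \<omega> n", OF assms] by blast
qed

lemma first_beyond_overshoot:
  assumes \<omega>: "\<omega> \<in> Omega L M" and \<sigma>: "\<sigma> \<in> {1, -1}" and h: "0 \<le> h" and fb: "first_beyond \<omega> \<sigma> h n"
  shows "\<sigma> * walk \<omega> n \<le> h + int L"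
proof -
  have "n \<noteq> 0" using fb h by (cases n) (auto simp: first_beyond_def)
  then obtain s where s: "n = Suc s" by (cases n) auto
  then have "\<sigma> * walk \<omega> s \<le> h" using fb by (auto simp: first_beyond_def)
  then show ?thesis using walk_step_le[OF \<omega>, of s] \<sigma> unfolding s by (auto simp: abs_le_iff)
qed

text \<open>Strictly before the first passage beyond \<open>h\<close> the walk stays at level at most \<open>h\<close>, so neither the
cookies beyond \<open>H\<close> nor those at the site of first passage have been looked at.\<close>
lemma first_beyond_cong:
  assumes agree: "\<And>j z. \<sigma> * z \<le> H \<Longrightarrow> \<omega> (j, z) = \<omega>' (j, z)"
    and fb: "first_beyond \<omega> \<sigma> h n" and "h \<le> H"
  shows "first_beyond \<omega>' \<sigma> h n" and "walk \<omega>' n = walk \<omega> n"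
proof -
  have w: "walk \<omega>' i = walk \<omega> i" if "i \<le> n" for i
  proof (rule walk_cong_visited)
    fix s j assume "s < i"
    then have "\<sigma> * walk \<omega> s \<le> h" using fb that by (auto simp: first_beyond_def)
    then show "\<omega> (j, walk \<omega> s) = \<omega>' (j, walk \<omega> s)" using agree \<open>h \<le> H\<close> by simp
  qed
  then show "first_beyond \<omega>' \<sigma> h n" "walk \<omega>' n = walk \<omega> n"
    using fb by (auto simp: first_beyond_def)
qed

text \<open>The walk exceeds each of the levels \<open>0, L, \<dots>, (m-1)L\<close> on the side \<open>\<sigma>\<close>, and each time the site of first
passage does not hold it forever. The quantified site \<open>z\<close> keeps the index of the cookie deterministic, so that
the event is visibly a countable combination of measurable ones.\<close>
definition passes_barriers :: "nat \<Rightarrow> nat \<Rightarrow> int \<Rightarrow> nat \<Rightarrow> env set" where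
  "passes_barriers L M \<sigma> m = {\<omega> \<in> Omega L M.
     \<forall>i<m. \<exists>n z. walk \<omega> n = z \<and> first_beyond \<omega> \<sigma> (int (i * L)) n \<and> (\<exists>j<M. \<omega> (j, z) \<noteq> 0)}"

text \<open>The first passage beyond level \<open>iL\<close> overshoots by at most \<open>L\<close>, so for \<open>i < m\<close> its site is still within
level \<open>mL\<close>: the event is decided by the sites up to that level.\<close>
lemma passes_barriers_cong:
  assumes \<omega>: "\<omega> \<in> passes_barriers L M \<sigma> m" and \<omega>': "\<omega>' \<in> Omega L M" and \<sigma>: "\<sigma> \<in> {1, -1}"
    and agree: "\<And>j z. \<sigma> * z \<le> int (m * L) \<Longrightarrow> \<omega> (j, z) = \<omega>' (j, z)"
  shows "\<omega>' \<in> passes_barriers L M \<sigma> m"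
proof -
  have "\<exists>n z. walk \<omega>' n = z \<and> first_beyond \<omega>' \<sigma> (int (i * L)) n \<and> (\<exists>j<M. \<omega>' (j, z) \<noteq> 0)"
    if i: "i < m" for i
  proof -
    obtain n j where n: "first_beyond \<omega> \<sigma> (int (i * L)) n" "j < M" "\<omega> (j, walk \<omega> n) \<noteq> 0"
      using \<omega> i unfolding passes_barriers_def by blast
    have "Suc i * L \<le> m * L" using i by (intro mult_le_mono1) simp
    then have le: "int (i * L) + int L \<le> int (m * L)"
      by (simp only: of_nat_add[symmetric] of_nat_le_iff mult_Suc add.commute)
    then have "int (i * L) \<le> int (m * L)" by linarith
    note fb = first_beyond_cong[OF agree n(1) this]
    have "\<sigma> * walk \<omega> n \<le> int (m * L)"
      using first_beyond_overshoot[OF _ \<sigma> _ n(1), of L M] \<omega> le by (simp add: passes_barriers_def)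
    then have "\<omega>' (j, walk \<omega> n) \<noteq> 0" using agree n(3) by simp
    then show ?thesis using fb n(2) by blast
  qed
  then show ?thesis using \<omega>' by (auto simp: passes_barriers_def)
qed

text \<open>A site whose cookies are all \<open>0\<close> is never left, and sites of first passage beyond levels \<open>iL \<ge> 0\<close> differ
from \<open>0\<close>. So a walk that is at \<open>0\<close> at the later time \<open>T\<close> has passed the barriers on its way to \<open>walk \<omega> n\<close>.\<close>
lemma passes_barriers_of_return:
  assumes \<omega>: "\<omega> \<in> Omega L M" and M: "M \<ge> 1" and ret: "n \<le> T" "walk \<omega> T = 0"
    and far: "int ((m - 1) * L) < \<sigma> * walk \<omega> n"
  shows "\<omega> \<in> passes_barriers L M \<sigma> m"
proof -
  have "\<exists>n z. walk \<omega> n = z \<and> first_beyond \<omega> \<sigma> (int (i * L)) n \<and> (\<exists>j<M. \<omega> (j, z) \<noteq> 0)"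
    if "i < m" for i
  proof -
    have "int (i * L) \<le> int ((m - 1) * L)"
      using that by (simp only: of_nat_le_iff) (intro mult_le_mono1, simp)
    then have "int (i * L) < \<sigma> * walk \<omega> n" using far by linarith
    then obtain n' where n': "n' \<le> n" "first_beyond \<omega> \<sigma> (int (i * L)) n'"
      by (rule first_beyond_exists)
    have "\<exists>j<M. \<omega> (j, walk \<omega> n') \<noteq> 0"
    proof (rule ccontr)
      assume "\<not> ?thesis"
      then have zero: "\<omega> (j, walk \<omega> n') = 0" if "j < M" for j using that by blast
      have "\<omega> (j, walk \<omega> n') = 0" for j
        using zero[of j] zero[of "M - 1"] Omega_last[OF \<omega>, of j "walk \<omega> n'"] M by (cases "j < M") auto
      then have "walk \<omega> T = walk \<omega> n'" using n'(1) ret(1) by (intro walk_stuck) auto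
      moreover have "0 \<le> int (i * L)" by simp
      ultimately show False using n'(2) ret(2) by (simp add: first_beyond_def del: of_nat_mult)
    qed
    then show ?thesis using n'(2) by blast
  qed
  then show ?thesis using \<omega> by (auto simp: passes_barriers_def)
qed

context iid_cookies
begin

lemma measurable_walk_env [measurable]:
  "(\<lambda>\<omega>. walk \<omega> n) \<in> env_measure L M \<mu> \<rightarrow>\<^sub>M count_space UNIV"
  using measurable_walk[of n L M] by (simp cong: measurable_cong_sets)

lemma pred_first_beyond [measurable]:
  "Measurable.pred (env_measure L M \<mu>) (\<lambda>\<omega>. first_beyond \<omega> \<sigma> h n)"
proof -
  have [measurable]: "Measurable.pred (env_measure L M \<mu>) (\<lambda>\<omega>. h < \<sigma> * walk \<omega> i)"
      "Measurable.pred (env_measure L M \<mu>) (\<lambda>\<omega>. \<sigma> * walk \<omega> i \<le> h)" for i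
    by (rule measurable_compose[OF measurable_walk_env], simp)+
  show ?thesis unfolding first_beyond_def by measurable
qed

lemma passes_barriers_events: "passes_barriers L M \<sigma> m \<in> events"
proof -
  have "{\<omega> \<in> space (env_measure L M \<mu>). \<forall>i<m. \<exists>n z. walk \<omega> n = z \<and>
      first_beyond \<omega> \<sigma> (int (i * L)) n \<and> (\<exists>j<M. \<omega> (j, z) \<noteq> 0)} \<in> events"
    by measurable
  then show ?thesis by (simp only: passes_barriers_def space_env_measure)
qed

text \<open>Decompose according to the site \<open>x\<close> of first passage beyond level \<open>mL\<close>, one of the \<open>L\<close> sites above that level.
Which \<open>x\<close> it is, and whether the earlier barriers are passed, depends on the sites up to level \<open>mL\<close>, while the
cookies at \<open>x\<close> are independent of these and not all \<open>0\<close> with probability at most \<open>1 - mu_min^M\<close>.\<close>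
lemma prob_passes_barriers_Suc:
  assumes \<sigma>: "\<sigma> \<in> {1, -1}"
  shows "prob (passes_barriers L M \<sigma> (Suc m)) \<le> (1 - mu_min L \<mu> ^ M) * prob (passes_barriers L M \<sigma> m)"
proof -
  let ?E = "env_measure L M \<mu>" and ?h = "int (m * L)"
  define X where "X = {x. ?h < \<sigma> * x \<and> \<sigma> * x \<le> ?h + int L}"
  define trap where "trap x = {\<omega> \<in> Omega L M. \<forall>j<M. \<omega> (j, x) = 0}" for x
  define F where "F x = passes_barriers L M \<sigma> m \<inter>
    {\<omega> \<in> Omega L M. \<exists>n. walk \<omega> n = x \<and> first_beyond \<omega> \<sigma> ?h n}" for x
  have h: "0 \<le> ?h" by simp
  then have "X \<subseteq> {- (?h + int L)..?h + int L}" using \<sigma> by (auto simp: X_def simp del: of_nat_mult)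
  then have finX: "finite X" by (rule finite_subset) simp
  have "{\<omega> \<in> space ?E. \<exists>n. walk \<omega> n = x \<and> first_beyond \<omega> \<sigma> ?h n} \<in> events" for x by measurable
  then have F_ev: "F x \<in> events" for x
    unfolding F_def by (intro sets.Int passes_barriers_events) simp
  have "{\<omega> \<in> space ?E. \<forall>j<M. \<omega> (j, x) = 0} \<in> events" for x by measurable
  then have trap_ev: "trap x \<in> events" for x by (simp only: trap_def space_env_measure)
  have trap_prob: "mu_min L \<mu> ^ M \<le> prob (trap x)" for x
    using prob_cylinder_ge[of "{x}" "\<lambda>_. 0"] by (simp add: trap_def)
  have F_dep: "depends_on L M {z. \<sigma> * z \<le> ?h} (F x)" for x
    unfolding depends_on_def
  proof (intro ballI impI)
    fix \<omega> \<omega>' assume \<omega>': "\<omega>' \<in> Omega L M" and "\<forall>j. \<forall>z\<in>{z. \<sigma> * z \<le> ?h}. \<omega> (j, z) = \<omega>' (j, z)"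
      and F: "\<omega> \<in> F x"
    then have agree: "\<And>j z. \<sigma> * z \<le> ?h \<Longrightarrow> \<omega> (j, z) = \<omega>' (j, z)" by simp
    obtain n where n: "walk \<omega> n = x" "first_beyond \<omega> \<sigma> ?h n" using F by (auto simp: F_def)
    then have "walk \<omega>' n = x" "first_beyond \<omega>' \<sigma> ?h n"
      using first_beyond_cong[OF agree n(2)] by auto
    moreover have "\<omega>' \<in> passes_barriers L M \<sigma> m"
      using passes_barriers_cong[OF _ \<omega>' \<sigma> agree] F by (simp add: F_def)
    ultimately show "\<omega>' \<in> F x" using \<omega>' by (auto simp: F_def)
  qed
  have free_dep: "depends_on L M {x} (space ?E - trap x)" for x
    by (auto simp: depends_on_def trap_def)
  have piece_ev: "F x \<inter> (space ?E - trap x) \<in> events" for x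
    by (intro sets.Int sets.Diff sets.top F_ev trap_ev)
  have disj: "disjoint_family_on F X"
    by (auto simp: disjoint_family_on_def F_def dest: first_beyond_unique)
  have "passes_barriers L M \<sigma> (Suc m) \<subseteq> (\<Union>x\<in>X. F x \<inter> (space ?E - trap x))"
  proof
    fix \<omega> assume \<omega>: "\<omega> \<in> passes_barriers L M \<sigma> (Suc m)"
    then have \<Omega>: "\<omega> \<in> Omega L M" by (simp add: passes_barriers_def)
    obtain n j where n: "first_beyond \<omega> \<sigma> ?h n" "j < M" "\<omega> (j, walk \<omega> n) \<noteq> 0"
      using \<omega> unfolding passes_barriers_def by blast
    have "walk \<omega> n \<in> X"
      using first_beyond_overshoot[OF \<Omega> \<sigma> _ n(1)] n(1) by (auto simp: X_def first_beyond_def)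
    moreover have "\<omega> \<in> F (walk \<omega> n)"
      using \<omega> \<Omega> n(1) by (auto simp: F_def passes_barriers_def)
    moreover have "\<omega> \<in> space ?E - trap (walk \<omega> n)" using n \<Omega> by (auto simp: trap_def)
    ultimately show "\<omega> \<in> (\<Union>x\<in>X. F x \<inter> (space ?E - trap x))" by blast
  qed
  then have "prob (passes_barriers L M \<sigma> (Suc m)) \<le> prob (\<Union>x\<in>X. F x \<inter> (space ?E - trap x))"
    by (rule finite_measure_mono) (intro sets.finite_UN finX piece_ev)
  also have "\<dots> \<le> (\<Sum>x\<in>X. prob (F x \<inter> (space ?E - trap x)))"
    using piece_ev finX by (intro finite_measure_subadditive_finite) blast+
  also have "\<dots> \<le> (\<Sum>x\<in>X. (1 - mu_min L \<mu> ^ M) * prob (F x))"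
  proof (rule sum_mono)
    fix x assume "x \<in> X"
    then have "{z. \<sigma> * z \<le> ?h} \<inter> {x} = {}" by (simp add: X_def)
    then have "prob (F x \<inter> (space ?E - trap x)) = prob (F x) * prob (space ?E - trap x)"
      by (rule prob_Int_disjoint_sites[OF F_ev F_dep sets.compl_sets[OF trap_ev] free_dep])
    also have "\<dots> = prob (F x) * (1 - prob (trap x))"
      by (simp only: prob_compl[OF trap_ev])
    also have "\<dots> \<le> prob (F x) * (1 - mu_min L \<mu> ^ M)"
      using trap_prob[of x] by (intro mult_left_mono) auto
    finally show "prob (F x \<inter> (space ?E - trap x)) \<le> (1 - mu_min L \<mu> ^ M) * prob (F x)"
      by (simp add: mult.commute)
  qed
  also have "\<dots> = (1 - mu_min L \<mu> ^ M) * (\<Sum>x\<in>X. prob (F x))"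
    by (rule sum_distrib_left[symmetric])
  also have "(\<Sum>x\<in>X. prob (F x)) = prob (\<Union>x\<in>X. F x)"
    by (rule finite_measure_finite_Union[OF finX _ disj, symmetric]) (use F_ev in blast)
  also have "(1 - mu_min L \<mu> ^ M) * \<dots> \<le> (1 - mu_min L \<mu> ^ M) * prob (passes_barriers L M \<sigma> m)"
  proof (rule mult_left_mono)
    have "(\<Union>x\<in>X. F x) \<subseteq> passes_barriers L M \<sigma> m" unfolding F_def by blast
    then show "prob (\<Union>x\<in>X. F x) \<le> prob (passes_barriers L M \<sigma> m)"
      by (rule finite_measure_mono) (rule passes_barriers_events)
    show "0 \<le> 1 - mu_min L \<mu> ^ M" using mu_min_power_le_1 by simp
  qed
  finally show ?thesis .
qed

lemma prob_passes_barriers_le: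
  assumes \<sigma>: "\<sigma> \<in> {1, -1}"
  shows "prob (passes_barriers L M \<sigma> m) \<le> (1 - mu_min L \<mu> ^ M) ^ m"
proof (induction m)
  case (Suc m)
  have "mu_min L \<mu> ^ M \<le> 1"
    by (rule mu_min_power_le_1)
  then have "(1 - mu_min L \<mu> ^ M) * prob (passes_barriers L M \<sigma> m)
      \<le> (1 - mu_min L \<mu> ^ M) * (1 - mu_min L \<mu> ^ M) ^ m"
    using Suc by (intro mult_left_mono) auto
  then show ?case
    unfolding power_Suc by (rule order_trans[OF prob_passes_barriers_Suc[OF \<sigma>]])
qed (simp add: prob_le_1)

lemma prob_D0_le_of_large:
  assumes L: "L \<ge> 1" and M: "M \<ge> 2" and k: "M\<^sup>2 \<le> k"
  shows "prob {\<omega> \<in> Omega L M. D0 \<omega> = enat k}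
    \<le> 2 * (1 - mu_min L \<mu> ^ M) powr (real k / (2 * real L * real M))"
proof -
  define x where "x = real k / (2 * real L * real M)"
  \<comment> \<open>the number of levels below distance \<open>k / (2M)\<close>: \<open>(m - 1) L < k / (2M)\<close>\<close>
  define m where "m = nat \<lceil>x\<rceil>"
  have "k > 0" using k M by (intro gr0I) simp
  then have "x > 0" using L M by (simp add: x_def)
  then have m_ge: "x \<le> real m" and m_less: "real (m - 1) < x"
    unfolding m_def by linarith+
  have "{\<omega> \<in> Omega L M. D0 \<omega> = enat k} \<subseteq> passes_barriers L M 1 m \<union> passes_barriers L M (-1) m"
  proof safe
    fix \<omega> assume \<omega>: "\<omega> \<in> Omega L M" and D: "D0 \<omega> = enat k"
      and left: "\<omega> \<notin> passes_barriers L M (-1) m"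
    obtain n T where n: "n \<le> T" "walk \<omega> T = 0" "int k \<le> 2 * int M * \<bar>walk \<omega> n\<bar>"
      using many_returns_imp_far[OF \<omega> D M k] by blast
    have "real k \<le> 2 * real M * real_of_int \<bar>walk \<omega> n\<bar>"
      using n(3) by (metis (mono_tags) of_int_le_iff of_int_mult of_int_numeral of_int_of_nat_eq)
    moreover have "2 * real M * (real (m - 1) * real L) < real k"
      using m_less L M by (simp add: x_def field_simps)
    ultimately have "2 * real M * (real (m - 1) * real L) < 2 * real M * real_of_int \<bar>walk \<omega> n\<bar>"
      by linarith
    then have "real (m - 1) * real L < real_of_int \<bar>walk \<omega> n\<bar>"
      using M by (simp only: mult_less_cancel_left_pos)
    then have far: "int ((m - 1) * L) < \<bar>walk \<omega> n\<bar>"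
      by (metis of_int_less_iff of_int_of_nat_eq of_nat_mult)
    have M1: "M \<ge> 1" using M by simp
    have "\<not> int ((m - 1) * L) < -1 * walk \<omega> n"
      using passes_barriers_of_return[OF \<omega> M1 n(1,2)] left by blast
    then have "int ((m - 1) * L) < 1 * walk \<omega> n" using far by linarith
    then show "\<omega> \<in> passes_barriers L M 1 m"
      by (rule passes_barriers_of_return[OF \<omega> M1 n(1,2)])
  qed
  then have "prob {\<omega> \<in> Omega L M. D0 \<omega> = enat k}
      \<le> prob (passes_barriers L M 1 m \<union> passes_barriers L M (-1) m)"
    by (rule finite_measure_mono) (intro sets.Un passes_barriers_events)
  also have "\<dots> \<le> prob (passes_barriers L M 1 m) + prob (passes_barriers L M (-1) m)"
    by (intro measure_Un_le passes_barriers_events)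
  also have "\<dots> \<le> 2 * (1 - mu_min L \<mu> ^ M) ^ m"
    using prob_passes_barriers_le[of 1 m] prob_passes_barriers_le[of "-1" m] by simp
  finally have "prob {\<omega> \<in> Omega L M. D0 \<omega> = enat k} \<le> 2 * (1 - mu_min L \<mu> ^ M) ^ m" .
  moreover have "mu_min L \<mu> ^ M < 1"
    using mu_min_pos mu_min_le_half[OF L] M by (simp add: power_less_one_iff)
  then have "(1 - mu_min L \<mu> ^ M) ^ m \<le> (1 - mu_min L \<mu> ^ M) powr x"
    using m_ge mu_min_pos by (subst powr_realpow[symmetric]) (auto intro!: powr_mono')
  ultimately show ?thesis unfolding x_def by linarith
qed

text \<open>The exponent is at most \<open>M\<close>, and \<open>mu_min \<le> 1/2\<close>, so Bernoulli's inequality bounds the power from below by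
\<open>1 - M / 4^M \<ge> 1/2\<close>.\<close>
lemma one_le_bound_of_small:
  assumes L: "L \<ge> 2" and M: "M \<ge> 2" and k: "k \<le> M\<^sup>2"
  shows "1 \<le> 2 * (1 - mu_min L \<mu> ^ (2 * M + L - 2)) powr (real k / (2 * real L * real M))"
proof -
  let ?p = "mu_min L \<mu> ^ (2 * M + L - 2)"
  have half: "mu_min L \<mu> \<le> 1 / 2" using L by (intro mu_min_le_half) simp
  have "?p \<le> mu_min L \<mu> ^ (2 * M)"
    using L mu_min_pos half by (intro power_decreasing) auto
  also have "\<dots> \<le> (1 / 2) ^ (2 * M)"
    using mu_min_pos half by (intro power_mono) auto
  finally have p: "?p \<le> (1 / 2) ^ (2 * M)" .
  have "(1 / 2 :: real) ^ (2 * M) \<le> (1 / 2) ^ 1"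
    using M by (intro power_decreasing) auto
  then have p1: "?p \<le> 1 / 2" using p by simp
  have "real M \<le> 2 ^ M" using of_nat_less_two_power[of M, where 'a = real] by simp
  then have "real M * ?p \<le> 2 ^ M * (1 / 2) ^ (2 * M)"
    using p mu_min_pos by (intro mult_mono) auto
  also have "\<dots> = (1 / 2) ^ M" by (simp add: mult_2 power_add power_divide)
  also have "\<dots> \<le> (1 / 2) ^ 1" using M by (intro power_decreasing) auto
  finally have "1 / 2 \<le> 1 + real M * (- ?p)" by simp
  also have "\<dots> \<le> (1 + (- ?p)) ^ M"
    using p1 by (intro Bernoulli_inequality) simp
  also have "\<dots> = (1 - ?p) powr real M" using p1 by (simp add: powr_realpow)
  also have "\<dots> \<le> (1 - ?p) powr (real k / (2 * real L * real M))"
  proof (rule powr_mono')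
    have "real k \<le> real M * real M" using k by (simp add: power2_eq_square flip: of_nat_mult)
    also have "\<dots> \<le> real M * (real M * (2 * real L))"
      using L M by (intro mult_left_mono) (auto simp: mult_le_cancel_left1)
    finally show "real k / (2 * real L * real M) \<le> real M"
      using L M by (simp add: field_simps)
  qed (use p1 mu_min_pos in auto)
  finally show ?thesis by simp
qed

lemma prob_D0_le:
  assumes L: "L \<ge> 2" and M: "M \<ge> 2"
  shows "prob {\<omega> \<in> Omega L M. D0 \<omega> = enat k}
    \<le> 2 * (1 - mu_min L \<mu> ^ (2 * M + L - 2)) powr (real k / (2 * real L * real M))"
proof (cases "M\<^sup>2 \<le> k")
  case True
  have "mu_min L \<mu> ^ (2 * M + L - 2) \<le> mu_min L \<mu> ^ M"
    using L mu_min_pos mu_min_le_1 by (intro power_decreasing) auto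
  moreover have "mu_min L \<mu> ^ M \<le> 1" by (rule mu_min_power_le_1)
  ultimately have "(1 - mu_min L \<mu> ^ M) powr (real k / (2 * real L * real M))
      \<le> (1 - mu_min L \<mu> ^ (2 * M + L - 2)) powr (real k / (2 * real L * real M))"
    by (intro powr_mono2) auto
  then show ?thesis using prob_D0_le_of_large[OF _ M True] L by linarith
next
  case False
  then have "k \<le> M\<^sup>2" by simp
  then show ?thesis
    by (rule order_trans[OF prob_le_1 one_le_bound_of_small[OF L M]])
qed

end

section \<open>The bounds for the number of visits\<close>

theorem theorem2:
  fixes L M k :: nat and \<mu> :: "int pmf"
  assumes "L \<ge> 2" and "M \<ge> 2"
    and "set_pmf \<mu> = {- int L..int L}"
    and "k \<ge> 1"
  shows "mu_min L \<mu> ^ (4 * M * k)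
           \<le> measure (env_measure L M \<mu>) {\<omega> \<in> Omega L M. D0 \<omega> = enat k}
         \<and> measure (env_measure L M \<mu>) {\<omega> \<in> Omega L M. D0 \<omega> = enat k}
           \<le> 2 * (1 - mu_min L \<mu> ^ (2 * M + L - 2)) powr (real k / (2 * real L * real M))"
proof -
  interpret iid_cookies L M \<mu> using assms by unfold_locales auto
  show ?thesis using assms prob_D0_ge prob_D0_le by blast
qed

end
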